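(* For every integer $n\ge 21$ there exists a graph $G$ of order $n$ with $$\mu_1(G)+\mu_2(G)>\frac{29+\sqrt{329}}{42}\,n-25.$$
   Context: Graphs are finite, simple and undirected; the order of a graph is its number of vertices. For a graph $G$ of order $n$, $\mu_1(G)\ge\cdots\ge\mu_n(G)$ are the eigenvalues of its adjacency matrix, listed with multiplicity. *)

theory Defs
  imports
    "Graph_Theory.Pair_Digraph"
    "Jordan_Normal_Form.Char_Poly"
begin

(* A finite simple undirected graph is a pair_graph: a finite, loop-free, symmetric
   arc relation, in which an edge {u, v} is represented by the two arcs (u, v) and (v, u). *)

definition graph_order :: "'a pair_pre_digraph \<Rightarrow> nat" where
  "graph_order G = card (pverts G)"

(* Rows and columns are indexed by the vertices in increasing order. Another enumeration
   conjugates the matrix by a permutation and so leaves the eigenvalues unchanged. *)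
definition adjacency_matrix :: "'a::linorder pair_pre_digraph \<Rightarrow> real mat" where
  "adjacency_matrix G =
    (let vs = sorted_list_of_set (pverts G) in
      Matrix.mat (graph_order G) (graph_order G)
        (\<lambda>(i, j). if (vs ! i, vs ! j) \<in> parcs G then 1 else 0))"

(* The adjacency matrix of a pair_graph is real symmetric, so all complex roots of its
   characteristic polynomial are real and this list has length graph_order G. *)
definition graph_spectrum :: "'a::linorder pair_pre_digraph \<Rightarrow> real list" where
  "graph_spectrum G =
    rev (sorted_list_of_multiset (proots (char_poly (adjacency_matrix G))))"

(* The k-th largest eigenvalue, counted with multiplicity; meaningful for
   1 \<le> k \<le> graph_order G. *)
definition graph_eigenvalue :: "nat \<Rightarrow> 'a::linorder pair_pre_digraph \<Rightarrow> real" ("\<mu>") where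
  "\<mu> k G = graph_spectrum G ! (k - 1)"

end

(* For n = 7k + r with r < 7, take a clique on 3k vertices completely joined to two disjoint
   cliques on 2k vertices each, and add r isolated vertices. Vectors that are constant on the
   three cliques form an invariant subspace, in which (4, 3, 3) and (0, 1, -1) are eigenvectors
   for 6k - 1 and 2k - 1. Hence the sum of the two largest eigenvalues is at least
   8k - 2 > 8n/7 - 9, while (29 + sqrt 329)/42 < (29 + 19)/42 = 8/7. *)
theory Submission
  imports Defs
begin

text \<open>The blocks are consecutive intervals: the dominating clique lies below
  \<open>3 * k\<close>, the other two cliques are cut at \<open>5 * k\<close>, and the vertices from
  \<open>7 * k\<close> on are isolated. The two negated conditions remove the arcs between the
  second and third block.\<close>

definition clique_pair_join :: "nat \<Rightarrow> nat \<Rightarrow> nat pair_pre_digraph" where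
  "clique_pair_join n k =
    \<lparr>pverts = {0..<n},
     parcs = {(i, j). i < 7 * k \<and> j < 7 * k \<and> i \<noteq> j \<and>
       \<not> (3 * k \<le> i \<and> i < 5 * k \<and> 5 * k \<le> j) \<and>
       \<not> (3 * k \<le> j \<and> j < 5 * k \<and> 5 * k \<le> i)}\<rparr>"

definition block_fun :: "nat \<Rightarrow> 'a \<Rightarrow> 'a \<Rightarrow> 'a \<Rightarrow> nat \<Rightarrow> 'a::zero" where
  "block_fun k a b c j =
    (if j < 3 * k then a else if j < 5 * k then b else if j < 7 * k then c else 0)"

lemma sum_block_fun:
  fixes a b c :: real
  assumes "7 * k \<le> n"
  shows "(\<Sum>j = 0..<n. block_fun k a b c j) = 3 * k * a + 2 * k * b + 2 * k * c"
proof -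
  let ?f = "block_fun k a b c"
  have "sum ?f {0..<n} =
      sum ?f {0..<3*k} + sum ?f {3*k..<5*k} + sum ?f {5*k..<7*k} + sum ?f {7*k..<n}"
    using assms by (simp add: sum.atLeastLessThan_concat)
  also have "sum ?f {0..<3*k} = (\<Sum>j = 0..<3*k. a)"
    by (rule sum.cong) (auto simp: block_fun_def)
  also have "sum ?f {3*k..<5*k} = (\<Sum>j = 3*k..<5*k. b)"
    by (rule sum.cong) (auto simp: block_fun_def)
  also have "sum ?f {5*k..<7*k} = (\<Sum>j = 5*k..<7*k. c)"
    by (rule sum.cong) (auto simp: block_fun_def)
  also have "sum ?f {7*k..<n} = 0"
    by (rule sum.neutral) (auto simp: block_fun_def)
  finally show ?thesis by simp
qed

lemma pair_graph_clique_pair_join: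
  assumes "7 * k \<le> n"
  shows "pair_graph (clique_pair_join n k)"
proof
  let ?G = "clique_pair_join n k"
  show "finite (pverts ?G)" by (simp add: clique_pair_join_def)
  show "finite (parcs ?G)"
    by (rule finite_subset[of _ "{..<7 * k} \<times> {..<7 * k}"]) (auto simp: clique_pair_join_def)
  show "fst e \<in> pverts ?G" "snd e \<in> pverts ?G" "fst e \<noteq> snd e" if "e \<in> parcs ?G" for e
    using that assms by (auto simp: clique_pair_join_def)
  show "symmetric ?G"
    by (auto simp: symmetric_def sym_def arcs_ends_def clique_pair_join_def arc_to_ends_def)
qed

text \<open>The sorted vertex list is \<open>[0..<n]\<close>, so every vertex is its own matrix
  index.\<close>

lemma adjacency_matrix_clique_pair_join:
  "adjacency_matrix (clique_pair_join n k) =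
    Matrix.mat n n (\<lambda>(i, j). if (i, j) \<in> parcs (clique_pair_join n k) then 1 else 0)"
  by (rule eq_matI) (auto simp: adjacency_matrix_def graph_order_def clique_pair_join_def Let_def)

text \<open>This is the invariance of the block-constant vectors, with the quotient matrix written
  out. A vertex sees all of each block that it is joined to, and all of its own block except itself;
  hence the subtracted \<open>a\<close>, \<open>b\<close> and \<open>c\<close>.\<close>

lemma adjacency_matrix_mult_block_fun:
  assumes "7 * k \<le> n"
  shows "adjacency_matrix (clique_pair_join n k) *\<^sub>v vec n (block_fun k a b c) =
    vec n (block_fun k (3 * k * a + 2 * k * b + 2 * k * c - a)
      (3 * k * a + 2 * k * b - b) (3 * k * a + 2 * k * c - c))" (is "?A *\<^sub>v ?v = vec n ?w")
proof (rule eq_vecI)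
  fix i assume "i < dim_vec (vec n ?w)"
  then have i: "i < n" by simp
  let ?adj = "\<lambda>j. (i, j) \<in> parcs (clique_pair_join n k)"
  \<comment> \<open>Values as seen from vertex \<open>i\<close>: the second block is hidden from the
    third and conversely. Row \<open>i\<close> then acts as a full block sum minus the entry at
    \<open>i\<close> itself.\<close>
  let ?b = "if i < 5 * k then b else 0"
  let ?c = "if i < 3 * k \<or> 5 * k \<le> i then c else 0"
  have "(?A *\<^sub>v ?v) $ i = (\<Sum>j = 0..<n. (if ?adj j then 1 else 0) * block_fun k a b c j)"
    using i by (simp add: adjacency_matrix_clique_pair_join scalar_prod_def)
  also have "\<dots> = ?w i"
  proof (cases "i < 7 * k")
    case True
    then have "(if ?adj j then 1 else 0) * block_fun k a b c j =
        block_fun k a ?b ?c j - (if j = i then block_fun k a b c i else 0)" for j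
      by (cases "i < 3 * k"; cases "i < 5 * k"; cases "j < 3 * k"; cases "j < 5 * k";
          cases "j < 7 * k"; cases "j = i") (simp_all add: clique_pair_join_def block_fun_def)
    then have "(\<Sum>j = 0..<n. (if ?adj j then 1 else 0) * block_fun k a b c j) =
        (\<Sum>j = 0..<n. block_fun k a ?b ?c j - (if j = i then block_fun k a b c i else 0))"
      by (simp only:)
    also have "\<dots> = 3 * k * a + 2 * k * ?b + 2 * k * ?c - block_fun k a b c i"
      using i by (simp only: sum_subtractf sum_block_fun[OF assms]) simp
    also have "\<dots> = ?w i" using True by (auto simp: block_fun_def)
    finally show ?thesis .
  next
    case False
    then show ?thesis by (simp add: clique_pair_join_def block_fun_def)
  qed
  finally show "(?A *\<^sub>v ?v) $ i = vec n ?w $ i" using i by simp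
qed (simp add: adjacency_matrix_clique_pair_join)

lemma eigenvalue_clique_pair_join:
  assumes "0 < k" "7 * k \<le> n"
  shows "eigenvalue (adjacency_matrix (clique_pair_join n k)) (6 * real k - 1)"
    and "eigenvalue (adjacency_matrix (clique_pair_join n k)) (2 * real k - 1)"
proof -
  have *: "eigenvalue (adjacency_matrix (clique_pair_join n k)) l"
    if "3 * real k * a + 2 * real k * b + 2 * real k * c - a = l * a"
      "3 * real k * a + 2 * real k * b - b = l * b"
      "3 * real k * a + 2 * real k * c - c = l * c" "b \<noteq> 0" for a b c l :: real
  proof -
    \<comment> \<open>Index \<open>3 * k\<close> is the first vertex of the second block, where the
      vector takes the nonzero value \<open>b\<close>.\<close>
    have "vec n (block_fun k a b c) $ (3 * k) \<noteq> 0\<^sub>v n $ (3 * k)"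
      using assms that(4) by (simp add: block_fun_def)
    then have "vec n (block_fun k a b c) \<noteq> 0\<^sub>v n" by metis
    moreover have "vec n (block_fun k (l * a) (l * b) (l * c)) = l \<cdot>\<^sub>v vec n (block_fun k a b c)"
      by (rule eq_vecI) (auto simp: block_fun_def)
    then have "adjacency_matrix (clique_pair_join n k) *\<^sub>v vec n (block_fun k a b c) =
        l \<cdot>\<^sub>v vec n (block_fun k a b c)"
      by (simp only: adjacency_matrix_mult_block_fun[OF assms(2)] that(1-3))
    moreover have "dim_row (adjacency_matrix (clique_pair_join n k)) = n"
      by (simp add: adjacency_matrix_clique_pair_join)
    ultimately show ?thesis
      unfolding eigenvalue_def eigenvector_def by (metis vec_carrier)
  qed
  show "eigenvalue (adjacency_matrix (clique_pair_join n k)) (6 * real k - 1)"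
    by (rule *[of 4 3 3]) (simp_all add: algebra_simps)
  show "eigenvalue (adjacency_matrix (clique_pair_join n k)) (2 * real k - 1)"
    by (rule *[of 0 1 "-1"]) (simp_all add: algebra_simps)
qed

lemma rev_sorted_nth_ge:
  fixes x y :: "'a::linorder"
  assumes "sorted (rev xs)" "x \<in> set xs" "y \<in> set xs" "y < x"
  shows "x \<le> xs ! 0" "y \<le> xs ! 1"
proof -
  obtain i j where ij: "i < length xs" "xs ! i = x" "j < length xs" "xs ! j = y"
    using assms(2,3) by (auto simp: in_set_conv_nth)
  have mono: "xs ! q \<le> xs ! p" if "p \<le> q" "q < length xs" for p q
    using assms(1) that by (simp add: sorted_rev_iff_nth_mono)
  show "x \<le> xs ! 0" using mono[of 0 i] ij by simp
  \<comment> \<open>An occurrence of \<open>y\<close> at the head would force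
    \<open>x \<le> y\<close>; so \<open>y\<close> sits at index 1 or later.\<close>
  have "j \<noteq> 0"
    using mono[of 0 i] ij assms(4) by (metis leD le0)
  then show "y \<le> xs ! 1" using mono[of 1 j] ij by simp
qed

lemma eigenvalue_in_graph_spectrum:
  assumes "eigenvalue (adjacency_matrix G) x"
  shows "x \<in> set (graph_spectrum G)"
proof -
  have A: "adjacency_matrix G \<in> carrier_mat (graph_order G) (graph_order G)"
    by (simp add: adjacency_matrix_def Let_def)
  \<comment> \<open>Membership in \<open>proots\<close> amounts to being a root only for a nonzero
    polynomial; this one is monic.\<close>
  have "char_poly (adjacency_matrix G) \<noteq> 0"
    using degree_monic_char_poly[OF A] by (metis coeff_0 zero_neq_one)
  then show ?thesis
    using assms eigenvalue_root_char_poly[OF A] by (simp add: graph_spectrum_def)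
qed

text \<open>Two distinct eigenvalues already bound the two largest from below, so the rest of the
  spectrum need not be computed.\<close>

lemma graph_eigenvalue_ge:
  assumes "eigenvalue (adjacency_matrix G) x" "eigenvalue (adjacency_matrix G) y" "y < x"
  shows "x \<le> \<mu> 1 G" "y \<le> \<mu> 2 G"
proof -
  have "sorted (rev (graph_spectrum G))" by (simp add: graph_spectrum_def)
  from rev_sorted_nth_ge[OF this assms(1,2)[THEN eigenvalue_in_graph_spectrum] assms(3)]
  show "x \<le> \<mu> 1 G" "y \<le> \<mu> 2 G" by (simp_all add: graph_eigenvalue_def)
qed

theorem proposition6:
  fixes n :: nat
  assumes "n \<ge> 21"
  shows "\<exists>G :: nat pair_pre_digraph. pair_graph G \<and> graph_order G = n \<and>
    \<mu> 1 G + \<mu> 2 G > (29 + sqrt 329) / 42 * real n - 25"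
proof -
  define k where "k = n div 7"
  define G where "G = clique_pair_join n k"
  have k: "0 < k" "7 * k \<le> n" "n < 7 * k + 7" using assms by (auto simp: k_def)
  have "6 * real k - 1 \<le> \<mu> 1 G" "2 * real k - 1 \<le> \<mu> 2 G"
    using graph_eigenvalue_ge[OF eigenvalue_clique_pair_join[OF k(1,2)]] k(1)
    by (simp_all add: G_def)
  moreover have "(29 + sqrt 329) / 42 * real n \<le> 8 / 7 * real n"
  proof (rule mult_right_mono)
    have "sqrt 329 \<le> 19" by (rule real_le_lsqrt) simp_all
    then show "(29 + sqrt 329) / 42 \<le> 8 / 7" by simp
  qed simp
  \<comment> \<open>This gives \<open>8 * k - 2 > 8 / 7 * n - 10\<close>, which leaves ample room
    below for the constant 25.\<close>
  moreover have "real n < 7 * real k + 7" using k(3) by linarith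
  ultimately have "(29 + sqrt 329) / 42 * real n - 25 < \<mu> 1 G + \<mu> 2 G" by linarith
  moreover have "pair_graph G" using k(2) by (simp add: G_def pair_graph_clique_pair_join)
  moreover have "graph_order G = n" by (simp add: G_def graph_order_def clique_pair_join_def)
  ultimately show ?thesis by blast
qed

end
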